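(* The set $\mathcal{C}(\partial D,\mathbb{C})\setminus\overline{\mathrm{Pol}(\partial D)}$ is maximal-spaceable.
   Context: $D=\{z\in\mathbb{C}:|z|<1\}$ and $\partial D$ is the unit circle. $\mathcal{C}(\partial D,\mathbb{C})$ is the Banach space of continuous functions $\partial D\to\mathbb{C}$ with the sup-norm. $\mathrm{Pol}(\partial D):=\{f|_{\partial D}:f\in\mathbb{C}[z]\}$ (complex polynomials in one variable restricted to $\partial D$), with norm closure $\overline{\mathrm{Pol}(\partial D)}$. For a topological vector space $V$, a subset $M\subseteq V$ and a cardinal $\kappa$, $M$ is $\kappa$-spaceable if $M\cup\{0\}$ contains a closed vector subspace of $V$ of (algebraic) dimension $\kappa$; $M$ is maximal-spaceable if it is $\dim(V)$-spaceable, where $\dim(V)$ is the algebraic dimension of $V$. *)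

theory Defs
  imports "HOL-Analysis.Analysis" "HOL-Computational_Algebra.Polynomial"
begin

unbundle cardinal_syntax

section \<open>Spaceability\<close>

locale topological_vector_space = vector_space scale
  for scale :: "'a::real_normed_field \<Rightarrow> 'b::topological_ab_group_add \<Rightarrow> 'b" +
  assumes continuous_scale: "continuous_on UNIV (\<lambda>(c, x). scale c x)"
begin

text \<open>The library's dimension is a natural number, which is \<open>0\<close> for every
  infinite-dimensional space; here the dimension is the cardinal of a Hamel basis.
  Only meaningful for subspaces \<open>W\<close>.\<close>

definition card_dim :: "'b set \<Rightarrow> 'b rel"
  where "card_dim W = card_of (SOME B. independent B \<and> span B = W)"

lemma card_dim_basis:
  assumes "independent B" "span B = W"
  shows "card_of B =o card_dim W"
proof -
  let ?C = "SOME B. independent B \<and> span B = W"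
  have "independent ?C \<and> span ?C = W"
    by (rule someI[of _ B]) (use assms in simp)
  then obtain f where "bij_betw f B ?C"
    using bij_if_span_eq_span_bases[of B ?C] assms by auto
  then show ?thesis
    unfolding card_dim_def by (rule card_of_ordIsoI)
qed

lemma subspace_has_basis:
  assumes "subspace W"
  obtains B where "independent B" "span B = W"
  by (metis assms maximal_independent_subset span_subspace)

definition spaceable :: "'c rel \<Rightarrow> 'b set \<Rightarrow> bool"
  where "spaceable \<kappa> M \<longleftrightarrow>
    (\<exists>W. subspace W \<and> closed W \<and> W \<subseteq> M \<union> {0} \<and> card_dim W =o \<kappa>)"

definition maximal_spaceable :: "'b set \<Rightarrow> bool"
  where "maximal_spaceable M \<longleftrightarrow> spaceable (card_dim (UNIV :: 'b set)) M"

end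


section \<open>The unit circle and its continuous complex-valued functions\<close>

typedef circle = "sphere (0::complex) 1"
  by (rule exI[of _ 1]) simp

instantiation circle :: metric_space
begin

definition dist_circle :: "circle \<Rightarrow> circle \<Rightarrow> real"
  where "dist_circle z w = dist (Rep_circle z) (Rep_circle w)"

definition uniformity_circle :: "(circle \<times> circle) filter"
  where "uniformity_circle = (INF e\<in>{0 <..}. principal {(x, y). dist x y < e})"

definition open_circle :: "circle set \<Rightarrow> bool"
  where "open_circle S = (\<forall>x\<in>S. \<forall>\<^sub>F (x', y) in uniformity. x' = x \<longrightarrow> y \<in> S)"

instance
proof
  fix x y z :: circle
  show "dist x y = 0 \<longleftrightarrow> x = y"
    by (simp add: dist_circle_def Rep_circle_inject)
  show "dist x y \<le> dist x z + dist y z"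
    unfolding dist_circle_def by (rule dist_triangle2)
qed (rule open_circle_def uniformity_circle_def)+

end

lemma continuous_on_Rep_circle: "continuous_on S Rep_circle"
  by (auto simp: continuous_on_iff dist_circle_def)

lemma continuous_on_Abs_circle: "continuous_on (sphere 0 1) Abs_circle"
  by (auto simp: continuous_on_iff dist_circle_def Abs_circle_inverse)

lemma compact_circle: "compact (UNIV :: circle set)"
proof -
  have "compact (Abs_circle ` sphere 0 1)"
    by (intro compact_continuous_image continuous_on_Abs_circle) simp
  also have "Abs_circle ` sphere 0 1 = UNIV"
    using type_definition.Abs_image[OF type_definition_circle] .
  finally show ?thesis .
qed

text \<open>By compactness, \<open>circle \<Rightarrow>\<^sub>C complex\<close> is the space of all continuous
  functions on the circle; its norm is the sup-norm.\<close>

lemma bcontfun_circle_eq: "(bcontfun :: (circle \<Rightarrow> complex) set) = {f. continuous_on UNIV f}"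
proof -
  have "bounded (range f)" if "continuous_on UNIV f" for f :: "circle \<Rightarrow> complex"
    by (rule compact_imp_bounded[OF compact_continuous_image[OF that compact_circle]])
  then show ?thesis
    by (simp add: bcontfun_def set_eq_iff) blast
qed

lemma continuous_on_sphere_bcontfun:
  assumes "continuous_on (sphere 0 1) f"
  shows "\<exists>!g :: circle \<Rightarrow>\<^sub>C complex. \<forall>z. apply_bcontfun g z = f (Rep_circle z)"
proof -
  have "continuous_on UNIV (\<lambda>z. f (Rep_circle z))"
    using Rep_circle
    by (intro continuous_on_compose2[OF assms continuous_on_Rep_circle]) auto
  then have "(\<lambda>z. f (Rep_circle z)) \<in> bcontfun"
    by (simp add: bcontfun_circle_eq)
  then obtain g where "(\<lambda>z. f (Rep_circle z)) = apply_bcontfun g"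
    by (rule bcontfunE)
  then show ?thesis
    by (metis bcontfun_eqI)
qed

text \<open>The library only provides real scalar multiplication on \<open>\<Rightarrow>\<^sub>C\<close>.\<close>

definition scale_circle :: "complex \<Rightarrow> (circle \<Rightarrow>\<^sub>C complex) \<Rightarrow> (circle \<Rightarrow>\<^sub>C complex)"
  where "scale_circle c f = Bcontfun (\<lambda>z. c * apply_bcontfun f z)"

lemma apply_scale_circle [simp]:
  "apply_bcontfun (scale_circle c f) z = c * apply_bcontfun f z"
proof -
  have "(\<lambda>z. c * apply_bcontfun f z) \<in> bcontfun"
    by (simp add: bcontfun_circle_eq continuous_on_mult_left)
  then show ?thesis
    by (simp add: scale_circle_def Bcontfun_inverse)
qed

lemma norm_scale_circle_le: "norm (scale_circle c f) \<le> norm c * norm f"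
  by (rule norm_bound) (simp add: norm_mult mult_left_mono norm_bounded)

global_interpretation C_circle: topological_vector_space scale_circle
proof -
  interpret vector_space scale_circle
    by unfold_locales (auto intro!: bcontfun_eqI simp: algebra_simps)
  have "bounded_bilinear scale_circle"
  proof
    show "\<exists>K. \<forall>c f. norm (scale_circle c f) \<le> norm c * norm f * K"
      by (rule exI[of _ 1]) (simp add: norm_scale_circle_le)
  qed (auto intro!: bcontfun_eqI simp: algebra_simps)
  then have "continuous_on UNIV (\<lambda>(c, f). scale_circle c f)"
    unfolding case_prod_unfold
    by (rule bounded_bilinear.continuous_on)
      (rule continuous_on_fst continuous_on_snd continuous_on_id)+
  then show "topological_vector_space scale_circle"
    by unfold_locales
qed

definition Pol_circle :: "(circle \<Rightarrow>\<^sub>C complex) set"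
  where "Pol_circle = {g. \<exists>p :: complex poly. \<forall>z. apply_bcontfun g z = poly p (Rep_circle z)}"

end

theory Submission
  imports Defs
begin

text \<open>
  Write \<open>V\<close> for the space of continuous functions on the circle.  The witness is the closed
  subspace \<open>W\<close> of all \<open>g\<close> with \<open>g (cnj z) = - g z\<close>.

  To see that \<open>W\<close> meets the closure of the polynomials only in \<open>0\<close>, consider the form
  \<open>Q g = Re (\<integral> g (z) * cnj (g (cnj z)))\<close>, integrated over the circle with respect to arc length.
  For a polynomial \<open>p\<close>, the integrand \<open>p (z) * cnj (p (cnj z))\<close> is again a polynomial in \<open>z\<close>, namely
  \<open>p\<close> times the polynomial with the conjugate coefficients.  The mean value property gives
  \<open>Q p = 2 * \<pi> * (cmod (p 0))\<^sup>2 \<ge> 0\<close>, and as \<open>Q\<close> is continuous for the sup-norm, \<open>Q \<ge> 0\<close> on the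
  closure (\<open>refl_form_nonneg_closure_Pol\<close>).  On \<open>W\<close>, however, \<open>Q g\<close> is minus the integral of
  \<open>(cmod g)\<^sup>2\<close>, so an element of both sets vanishes (\<open>odd_closure_Pol_imp_zero\<close>).

  For the dimension, no cardinal has to be computed: it is enough to embed \<open>V\<close> linearly and
  injectively into \<open>W\<close> (\<open>maximal_spaceable_if_embeds\<close>).  Composing with a continuous map \<open>\<psi>\<close> of the
  circle that satisfies \<open>\<psi> (cnj z) = \<psi> z\<close> produces functions that are invariant under conjugation,
  and multiplying by \<open>Im z\<close> makes them odd.  This is injective if \<open>\<psi>\<close> maps the points with
  \<open>Im z \<noteq> 0\<close> onto the whole circle; \<open>\<psi> (x + \<i> * y) = (x + \<i> * \<bar>y\<bar>) ^ 4\<close> does, since it winds twice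
  around the circle along the upper half circle.
\<close>

section \<open>Hamel dimension and linear embeddings\<close>

context topological_vector_space
begin

lemma card_independent_le_card_dim:
  assumes "independent B" "B \<subseteq> W" "subspace W"
  shows "card_of B \<le>o card_dim W"
proof -
  obtain C where C: "B \<subseteq> C" "C \<subseteq> W" "independent C" "W \<subseteq> span C"
    using maximal_independent_subset_extend[OF assms(2,1)] .
  have "card_of B \<le>o card_of C"
    using C(1) by (rule card_of_mono1)
  also have "card_of C =o card_dim W"
    using C assms(3) by (intro card_dim_basis span_subspace)
  finally show ?thesis .
qed

text \<open>An injective linear image of a Hamel basis of the whole space is an independent subset of
  \<open>W\<close>, so \<open>W\<close> has at least the dimension of the whole space; the converse inequality holds for
  every subspace.\<close>

lemma card_dim_eq_if_embeds:
  assumes "subspace W" "Vector_Spaces.linear scale scale T" "inj T" "range T \<subseteq> W"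
  shows "card_dim W =o card_dim UNIV"
proof -
  interpret T: Vector_Spaces.linear scale scale T
    by fact
  obtain B where B: "independent B" "span B = UNIV"
    using subspace_has_basis[OF subspace_UNIV] .
  have "card_dim UNIV =o card_of B"
    using card_dim_basis[OF B] by (rule ordIso_symmetric)
  also have "card_of B =o card_of (T ` B)"
    using assms(3) by (intro card_of_ordIsoI[of T] bij_betw_imageI) (auto intro: inj_on_subset)
  also have "card_of (T ` B) \<le>o card_dim W"
    using assms B
    by (intro card_independent_le_card_dim T.independent_injective_image)
      (auto intro: inj_on_subset)
  finally have ge: "card_dim UNIV \<le>o card_dim W" .
  obtain C where C: "independent C" "span C = W"
    using subspace_has_basis[OF assms(1)] .
  have "card_dim W =o card_of C"
    using card_dim_basis[OF C] by (rule ordIso_symmetric)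
  also have "card_of C \<le>o card_dim UNIV"
    using C by (intro card_independent_le_card_dim) auto
  finally show ?thesis
    using ge by (simp add: ordIso_iff_ordLeq)
qed

lemma maximal_spaceable_if_embeds:
  assumes "subspace W" "closed W" "W \<subseteq> M \<union> {0}"
    and "Vector_Spaces.linear scale scale T" "inj T" "range T \<subseteq> W"
  shows "maximal_spaceable M"
  unfolding maximal_spaceable_def spaceable_def
  using assms card_dim_eq_if_embeds by blast

end

section \<open>Conjugation on the circle and odd functions\<close>

text \<open>The sup-norm controls the change of the function uniformly in the point of evaluation, so
  function and point may vary together.  This makes the integrand of the form \<open>Q\<close> jointly continuous
  in the function and the angle.\<close>

lemma continuous_on_apply_bcontfun_joint [continuous_intros]:
  fixes f :: "'a::topological_space \<Rightarrow> 'b::topological_space \<Rightarrow>\<^sub>C 'c::metric_space"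
  assumes "continuous_on S f" "continuous_on S g"
  shows "continuous_on S (\<lambda>x. apply_bcontfun (f x) (g x))"
  unfolding continuous_on_def
proof
  fix x assume x: "x \<in> S"
  let ?F = "at x within S"
  have "((\<lambda>y. dist (f y) (f x)) \<longlongrightarrow> 0) ?F"
    using assms(1) x by (simp add: continuous_on_def flip: tendsto_dist_iff)
  then have 1: "((\<lambda>y. dist (apply_bcontfun (f y) (g y)) (apply_bcontfun (f x) (g y))) \<longlongrightarrow> 0) ?F"
    by (rule Lim_null_comparison[rotated]) (simp add: dist_bounded)
  have "continuous_on S (\<lambda>y. apply_bcontfun (f x) (g y))"
    by (rule continuous_on_compose2[OF _ assms(2)]) auto
  then have 2: "((\<lambda>y. apply_bcontfun (f x) (g y)) \<longlongrightarrow> apply_bcontfun (f x) (g x)) ?F"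
    using x by (simp add: continuous_on_def)
  have "((\<lambda>y. dist (apply_bcontfun (f y) (g y)) (apply_bcontfun (f x) (g y)) +
    dist (apply_bcontfun (f x) (g y)) (apply_bcontfun (f x) (g x))) \<longlongrightarrow> 0) ?F"
    using tendsto_add[OF 1 2[THEN tendsto_dist_iff[THEN iffD1]]] by simp
  then show "((\<lambda>y. apply_bcontfun (f y) (g y)) \<longlongrightarrow> apply_bcontfun (f x) (g x)) ?F"
    unfolding tendsto_dist_iff[of _ "apply_bcontfun (f x) (g x)"]
    by (rule Lim_null_comparison[rotated]) (simp add: dist_triangle)
qed

lemma continuous_on_into_circle:
  assumes "continuous_on S f" "\<And>x. x \<in> S \<Longrightarrow> cmod (f x) = 1"
  shows "continuous_on S (\<lambda>x. Abs_circle (f x))"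
  by (rule continuous_on_compose2[OF continuous_on_Abs_circle assms(1)]) (use assms(2) in auto)

lemma Rep_Abs_circle: "cmod z = 1 \<Longrightarrow> Rep_circle (Abs_circle z) = z"
  by (simp add: Abs_circle_inverse)

lemma norm_Rep_circle [simp]: "cmod (Rep_circle z) = 1"
  using Rep_circle[of z] by simp

definition circle_cnj :: "circle \<Rightarrow> circle"
  where "circle_cnj z = Abs_circle (cnj (Rep_circle z))"

lemma Rep_circle_cnj [simp]: "Rep_circle (circle_cnj z) = cnj (Rep_circle z)"
  by (simp add: circle_cnj_def Rep_Abs_circle)

lemma continuous_on_circle_cnj: "continuous_on S circle_cnj"
  unfolding circle_cnj_def
  by (intro continuous_on_into_circle continuous_intros continuous_on_Rep_circle) simp

definition circle_cis :: "real \<Rightarrow> circle"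
  where "circle_cis t = Abs_circle (cis t)"

lemma Rep_circle_cis [simp]: "Rep_circle (circle_cis t) = cis t"
  by (simp add: circle_cis_def Rep_Abs_circle)

lemma continuous_on_circle_cis: "continuous_on S circle_cis"
  unfolding circle_cis_def
  by (intro continuous_on_into_circle continuous_intros) simp

lemma circle_cis_cases:
  obtains t where "0 \<le> t" "t \<le> 2 * pi" "z = circle_cis t"
proof
  show "z = circle_cis (Arg2pi (Rep_circle z))"
    using Arg2pi[of "Rep_circle z"]
    by (simp add: cis_conv_exp is_Arg_def flip: Rep_circle_inject)
qed (use Arg2pi[of "Rep_circle z"] in auto)

definition odd_circle :: "(circle \<Rightarrow>\<^sub>C complex) set"
  where "odd_circle = {g. \<forall>z. apply_bcontfun g (circle_cnj z) = - apply_bcontfun g z}"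

lemma subspace_odd_circle: "C_circle.subspace odd_circle"
  by (auto simp: C_circle.subspace_def odd_circle_def)

lemma closed_odd_circle: "closed odd_circle"
  unfolding odd_circle_def
  by (intro closed_Collect_all closed_Collect_eq continuous_intros)

section \<open>The closure of the polynomials contains no odd function\<close>

lemma integral_poly_cis: "integral {0..2 * pi} (\<lambda>t. poly p (cis t)) = 2 * pi * poly p 0"
proof -
  have monomial: "((\<lambda>t. cis t ^ k) has_integral (if k = 0 then 2 * pi else 0)) {0..2 * pi}" for k
  proof (cases "k = 0")
    case True
    then show ?thesis
      using has_integral_const_real[of "1::complex" 0 "2 * pi"]
      by (simp add: scaleR_conv_of_real)
  next
    case False
    have "((\<lambda>t. cis (real k * t)) has_integral
      (cis (real k * (2 * pi)) / (\<i> * k) - cis (real k * 0) / (\<i> * k))) {0..2 * pi}"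
    proof (rule fundamental_theorem_of_calculus)
      fix t :: real
      show "((\<lambda>t. cis (real k * t) / (\<i> * k)) has_vector_derivative cis (real k * t))
        (at t within {0..2 * pi})"
        unfolding cis_conv_exp using False
        by (auto intro!: derivative_eq_intros has_vector_derivative_real_field simp: field_simps)
    qed simp
    moreover have "cis (real k * (2 * pi)) = 1"
      using cis_multiple_2pi[of "real k"] by (simp add: mult.commute mult.left_commute)
    ultimately show ?thesis
      using False by (simp add: Complex.DeMoivre)
  qed
  have "((\<lambda>t. \<Sum>k\<le>degree p. coeff p k * cis t ^ k) has_integral
    (\<Sum>k\<le>degree p. coeff p k * (if k = 0 then 2 * pi else 0))) {0..2 * pi}"
    by (intro has_integral_sum has_integral_mult_right) (auto simp: monomial[simplified])
  moreover have "(\<Sum>k\<le>degree p. coeff p k * (if k = 0 then 2 * pi else 0)) = 2 * pi * poly p 0"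
    by (simp add: if_distrib poly_0_coeff_0 cong: if_cong)
  ultimately show ?thesis
    by (simp add: poly_altdef integral_unique)
qed

text \<open>The real quadratic form \<open>Q\<close>: the inner product, in the square-integrable functions on the
  circle, of \<open>g\<close> with its composition with conjugation.\<close>

definition refl_form :: "(circle \<Rightarrow>\<^sub>C complex) \<Rightarrow> real"
  where "refl_form g = integral {0..2 * pi} (\<lambda>t.
    Re (apply_bcontfun g (circle_cis t) * cnj (apply_bcontfun g (circle_cnj (circle_cis t)))))"

lemma continuous_on_refl_form: "continuous_on UNIV refl_form"
proof -
  have cis: "continuous_on S (\<lambda>x. circle_cis (snd x))" for S :: "('a::topological_space \<times> real) set"
    by (rule continuous_on_compose2[OF continuous_on_circle_cis]) (auto intro: continuous_intros)
  then have "continuous_on S (\<lambda>x. circle_cnj (circle_cis (snd x)))"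
    for S :: "('a::topological_space \<times> real) set"
    by (rule continuous_on_compose2[OF continuous_on_circle_cnj]) auto
  with cis show ?thesis
    unfolding refl_form_def cbox_interval[symmetric]
    by (intro integral_continuous_on_param) (auto simp: case_prod_unfold intro!: continuous_intros)
qed

text \<open>Conjugating the value of a polynomial and its argument amounts to conjugating its
  coefficients, so the integrand is a polynomial in \<open>z\<close> alone and integrates to a multiple of its
  value at the origin.\<close>

lemma refl_form_nonneg_Pol:
  assumes "g \<in> Pol_circle"
  shows "refl_form g \<ge> 0"
proof -
  obtain p where p: "\<And>z. apply_bcontfun g z = poly p (Rep_circle z)"
    using assms by (auto simp: Pol_circle_def)
  let ?r = "p * map_poly cnj p"
  have "((\<lambda>t. poly ?r (cis t)) has_integral 2 * pi * poly ?r 0) {0..2 * pi}"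
    unfolding integral_poly_cis[symmetric]
    by (intro integrable_integral integrable_continuous_real continuous_intros)
  then have "((\<lambda>t. Re (poly ?r (cis t))) has_integral Re (2 * pi * poly ?r 0)) {0..2 * pi}"
    by (rule has_integral_linear[OF _ bounded_linear_Re, unfolded o_def])
  moreover have "poly p z * cnj (poly p (cnj z)) = poly ?r z" for z
    using poly_cnj[of p "cnj z"] by simp
  ultimately have "refl_form g = Re (2 * pi * poly ?r 0)"
    unfolding refl_form_def by (intro integral_unique) (simp only: p Rep_circle_cnj Rep_circle_cis)
  also have "poly ?r 0 = of_real ((cmod (poly p 0))\<^sup>2)"
    unfolding complex_norm_square using poly_cnj[of p 0] by simp
  finally show ?thesis
    by simp
qed

lemma refl_form_nonneg_closure_Pol:
  assumes "g \<in> closure Pol_circle"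
  shows "refl_form g \<ge> 0"
proof -
  have "closed {g. 0 \<le> refl_form g}"
    by (intro closed_Collect_le continuous_on_refl_form continuous_on_const)
  with refl_form_nonneg_Pol have "closure Pol_circle \<subseteq> {g. 0 \<le> refl_form g}"
    by (intro closure_minimal) auto
  with assms show ?thesis
    by auto
qed

lemma refl_form_odd:
  assumes "g \<in> odd_circle"
  shows "refl_form g = - integral {0..2 * pi} (\<lambda>t. (cmod (apply_bcontfun g (circle_cis t)))\<^sup>2)"
proof -
  have "Re (w * cnj (- w)) = - (cmod w)\<^sup>2" for w
    by (subst cmod_power2) (simp add: power2_eq_square)
  then show ?thesis
    using assms by (simp add: refl_form_def odd_circle_def del: complex_cnj_minus)
qed

lemma odd_closure_Pol_imp_zero:
  assumes "g \<in> odd_circle" "g \<in> closure Pol_circle"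
  shows "g = 0"
proof -
  let ?h = "\<lambda>t. (cmod (apply_bcontfun g (circle_cis t)))\<^sup>2"
  have cont: "continuous_on {0..2 * pi} ?h"
    by (intro continuous_intros continuous_on_circle_cis)
  have "integral {0..2 * pi} ?h \<le> 0"
    using refl_form_odd[OF assms(1)] refl_form_nonneg_closure_Pol[OF assms(2)] by simp
  moreover have "integral {0..2 * pi} ?h \<ge> 0"
    by (intro integral_nonneg integrable_continuous_real cont) simp
  ultimately have "\<forall>t\<in>{0..2 * pi}. ?h t = 0"
    by (subst integral_eq_0_iff[symmetric]) (auto simp: cont)
  then have zero: "apply_bcontfun g (circle_cis t) = 0" if "0 \<le> t" "t \<le> 2 * pi" for t
    using that by simp
  show ?thesis
  proof (rule bcontfun_eqI)
    show "apply_bcontfun g z = apply_bcontfun 0 z" for z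
      by (rule circle_cis_cases[of z]) (simp add: zero)
  qed
qed

section \<open>Embedding all continuous functions into the odd ones\<close>

definition fold_circle :: "circle \<Rightarrow> circle"
  where "fold_circle z =
    Abs_circle ((Complex (Re (Rep_circle z)) \<bar>Im (Rep_circle z)\<bar>) ^ 4)"

lemma norm_Complex_abs_Im: "cmod (Complex (Re z) \<bar>Im z\<bar>) = cmod z"
  by (simp add: cmod_def)

lemma continuous_on_fold_circle: "continuous_on S fold_circle"
  unfolding fold_circle_def Complex_eq
  by (intro continuous_on_into_circle continuous_intros continuous_on_Rep_circle)
    (simp add: norm_power norm_Complex_abs_Im flip: Complex_eq)

lemma fold_circle_cnj: "fold_circle (circle_cnj z) = fold_circle z"
  by (simp add: fold_circle_def)

text \<open>Every point \<open>w \<noteq> 1\<close> has a non-real fourth root, and one of its two signs lies in the upper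
  half plane; the remaining point \<open>1\<close> is reached from \<open>\<i>\<close>.  With the square in place of the fourth
  power the statement would fail for \<open>w = 1\<close>, whose only preimages are then \<open>1\<close> and \<open>-1\<close>.\<close>

lemma fold_circle_surj_nonreal:
  obtains z where "Im (Rep_circle z) \<noteq> 0" "fold_circle z = w"
proof -
  have root: "\<exists>u. u ^ 4 = Rep_circle w \<and> Im u \<noteq> 0"
  proof (cases "Rep_circle w = 1")
    case True
    then show ?thesis
      by (intro exI[of _ \<i>]) simp
  next
    case False
    define s where "s = csqrt (csqrt (Rep_circle w))"
    have "s ^ 4 = (s\<^sup>2)\<^sup>2"
      by (simp flip: power_mult)
    then have s: "s ^ 4 = Rep_circle w"
      by (simp add: s_def)
    have "Im s \<noteq> 0"
    proof
      assume "Im s = 0"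
      then have eq: "s = of_real (Re s)"
        by (simp add: complex_eq_iff)
      have "cmod s ^ 4 = 1"
        using s by (metis norm_Rep_circle norm_power)
      then have "\<bar>Re s\<bar> ^ 4 = 1"
        by (subst (asm) eq) simp
      then have "Re s ^ 4 = 1"
        by simp
      then have "s ^ 4 = 1"
        by (subst eq) (simp flip: of_real_power)
      with s False show False
        by simp
    qed
    with s show ?thesis
      by blast
  qed
  then obtain u where u: "u ^ 4 = Rep_circle w" "Im u > 0"
  proof (elim exE conjE)
    fix u assume "u ^ 4 = Rep_circle w" "Im u \<noteq> 0"
    then show thesis
      using that[of u] that[of "- u"] by (cases "Im u > 0") auto
  qed
  have "cmod u ^ 4 = 1"
    using u(1) by (metis norm_Rep_circle norm_power)
  then have norm: "cmod u = 1"
    using power_eq_1_iff[of "cmod u" 4] by simp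
  show thesis
  proof
    show "Im (Rep_circle (Abs_circle u)) \<noteq> 0"
      using u(2) by (simp add: Rep_Abs_circle norm)
    show "fold_circle (Abs_circle u) = w"
      using u by (simp add: fold_circle_def Rep_Abs_circle norm Rep_circle_inverse)
  qed
qed

definition odd_embed :: "(circle \<Rightarrow>\<^sub>C complex) \<Rightarrow> (circle \<Rightarrow>\<^sub>C complex)"
  where "odd_embed f =
    Bcontfun (\<lambda>z. of_real (Im (Rep_circle z)) * apply_bcontfun f (fold_circle z))"

lemma apply_odd_embed [simp]:
  "apply_bcontfun (odd_embed f) z = of_real (Im (Rep_circle z)) * apply_bcontfun f (fold_circle z)"
proof -
  have "(\<lambda>z. of_real (Im (Rep_circle z)) * apply_bcontfun f (fold_circle z)) \<in> bcontfun"
    by (auto simp: bcontfun_circle_eq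
      intro!: continuous_intros continuous_on_Rep_circle continuous_on_fold_circle)
  then show ?thesis
    by (simp add: odd_embed_def Bcontfun_inverse)
qed

lemma linear_odd_embed: "Vector_Spaces.linear scale_circle scale_circle odd_embed"
  by unfold_locales (auto intro!: bcontfun_eqI simp: algebra_simps)

lemma inj_odd_embed: "inj odd_embed"
proof (rule injI)
  fix f g assume eq: "odd_embed f = odd_embed g"
  show "f = g"
  proof (rule bcontfun_eqI)
    fix w
    obtain z where "Im (Rep_circle z) \<noteq> 0" "fold_circle z = w"
      by (rule fold_circle_surj_nonreal)
    then show "apply_bcontfun f w = apply_bcontfun g w"
      using arg_cong[OF eq, of "\<lambda>h. apply_bcontfun h z"] by simp
  qed
qed

lemma odd_embed_in_odd_circle: "odd_embed f \<in> odd_circle"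
  by (simp add: odd_circle_def fold_circle_cnj)

theorem theorem3p21:
  shows "C_circle.maximal_spaceable (UNIV - closure Pol_circle)"
proof (rule C_circle.maximal_spaceable_if_embeds)
  show "odd_circle \<subseteq> (UNIV - closure Pol_circle) \<union> {0}"
    using odd_closure_Pol_imp_zero by auto
  show "range odd_embed \<subseteq> odd_circle"
    using odd_embed_in_odd_circle by auto
qed (fact subspace_odd_circle closed_odd_circle linear_odd_embed inj_odd_embed)+

end
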